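(* For every $0<\beta<1$ there are constants $c_0(\beta),c_1(\beta)>0$ depending only on $\beta$ such that the following holds. Let $X$ be a centred, isotropic random vector in $\mathbb{R}^d$ with law $\mu$ such that $\mathbb{E}\|X\|_2\ge\beta\sqrt d$, and let $m\ge1$. Then with probability at least $c_0(\beta)$, $$\mathcal{SW}_2(\mu_m,\mu)\ge c_1(\beta)\sqrt{\frac dm}.$$
   Context: Isotropic means the covariance is the identity. $X_1,\dots,X_m$ are independent copies of $X$ and $\mu_m=\frac1m\sum_{i=1}^m\delta_{X_i}$. For a probability measure $\nu$ on $\mathbb{R}^d$ and $\theta$ in the Euclidean unit sphere $S^{d-1}$, $\nu^\theta$ is the push-forward of $\nu$ under $x\mapsto\langle x,\theta\rangle$. $\mathcal{W}_2(\tau,\nu)=\inf_\Pi\left(\int\|x-y\|_2^2\,\Pi(dx,dy)\right)^{1/2}$, the infimum over all couplings $\Pi$ of $\tau$ and $\nu$, and $\mathcal{SW}_2(\mu,\nu)=\sup_{\theta\in S^{d-1}}\mathcal{W}_2(\mu^\theta,\nu^\theta)$. *)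

theory Defs
  imports "HOL-Probability.Probability"
begin

text \<open>
  The constants of the main statement must not depend on the dimension, so the dimension
  cannot be a type. Vectors of \<open>\<real>\<^sup>d\<close> are the extensional functions on \<open>{..<d}\<close>; the Borel
  sigma-algebra of \<open>\<real>\<^sup>d\<close> is the product sigma-algebra, and the Euclidean norm of \<open>x\<close> is
  \<open>L2_set x {..<d}\<close>.
\<close>

definition euc :: "nat \<Rightarrow> (nat \<Rightarrow> real) measure" where
  "euc d = (\<Pi>\<^sub>M i\<in>{..<d}. borel)"

definition inner_euc :: "nat \<Rightarrow> (nat \<Rightarrow> real) \<Rightarrow> (nat \<Rightarrow> real) \<Rightarrow> real" where
  "inner_euc d x y = (\<Sum>i<d. x i * y i)"

definition unit_sphere :: "nat \<Rightarrow> (nat \<Rightarrow> real) set" where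
  "unit_sphere d = {\<theta> \<in> space (euc d). L2_set \<theta> {..<d} = 1}"

definition prob_law :: "nat \<Rightarrow> (nat \<Rightarrow> real) measure \<Rightarrow> bool" where
  "prob_law d \<mu> \<longleftrightarrow> prob_space \<mu> \<and> sets \<mu> = sets (euc d)"

definition centred :: "nat \<Rightarrow> (nat \<Rightarrow> real) measure \<Rightarrow> bool" where
  "centred d \<mu> \<longleftrightarrow> (\<forall>i<d. integrable \<mu> (\<lambda>x. x i) \<and> (\<integral>x. x i \<partial>\<mu>) = 0)"

definition covariance :: "(nat \<Rightarrow> real) measure \<Rightarrow> nat \<Rightarrow> nat \<Rightarrow> real" where
  "covariance \<mu> i j = (\<integral>x. (x i - (\<integral>y. y i \<partial>\<mu>)) * (x j - (\<integral>y. y j \<partial>\<mu>)) \<partial>\<mu>)"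

definition isotropic :: "nat \<Rightarrow> (nat \<Rightarrow> real) measure \<Rightarrow> bool" where
  "isotropic d \<mu> \<longleftrightarrow>
     (\<forall>i<d. integrable \<mu> (\<lambda>x. (x i)\<^sup>2)) \<and>
     (\<forall>i<d. \<forall>j<d. covariance \<mu> i j = (if i = j then 1 else 0))"

text \<open>
  Wasserstein costs are taken in the extended nonnegative reals, so that a coupling of infinite
  cost does not count as one of cost \<open>0\<close>.
\<close>

definition sqrt_ennreal :: "ennreal \<Rightarrow> ennreal" where
  "sqrt_ennreal x = (if x = \<infinity> then \<infinity> else ennreal (sqrt (enn2real x)))"

definition couplings :: "'a::euclidean_space measure \<Rightarrow> 'a measure \<Rightarrow> ('a \<times> 'a) measure set" where
  "couplings \<tau> \<nu> = {\<gamma>. prob_space \<gamma> \<and> sets \<gamma> = sets (borel \<Otimes>\<^sub>M borel) \<and>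
     distr \<gamma> borel fst = \<tau> \<and> distr \<gamma> borel snd = \<nu>}"

definition W2 :: "'a::euclidean_space measure \<Rightarrow> 'a measure \<Rightarrow> ennreal" where
  "W2 \<tau> \<nu> = (INF \<gamma>\<in>couplings \<tau> \<nu>.
     sqrt_ennreal (\<integral>\<^sup>+(x, y). ennreal ((norm (x - y))\<^sup>2) \<partial>\<gamma>))"

definition marginal :: "nat \<Rightarrow> (nat \<Rightarrow> real) \<Rightarrow> (nat \<Rightarrow> real) measure \<Rightarrow> real measure" where
  "marginal d \<theta> \<nu> = distr \<nu> borel (\<lambda>x. inner_euc d x \<theta>)"

definition SW2 :: "nat \<Rightarrow> (nat \<Rightarrow> real) measure \<Rightarrow> (nat \<Rightarrow> real) measure \<Rightarrow> ennreal" where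
  "SW2 d \<mu> \<nu> = (SUP \<theta>\<in>unit_sphere d. W2 (marginal d \<theta> \<mu>) (marginal d \<theta> \<nu>))"

text \<open>\<open>return (euc d) x\<close> is the Dirac measure at \<open>x\<close>.\<close>

definition empirical :: "nat \<Rightarrow> nat \<Rightarrow> (nat \<Rightarrow> nat \<Rightarrow> real) \<Rightarrow> (nat \<Rightarrow> real) measure" where
  "empirical d m x = measure_of (space (euc d)) (sets (euc d))
     (\<lambda>A. (\<Sum>i<m. emeasure (return (euc d) (x i)) A) / of_nat m)"

text \<open>
  A sample of \<open>m\<close> independent copies of a random vector with law \<open>\<mu>\<close> is a point of the \<open>m\<close>-fold
  product of \<open>\<mu>\<close>. Nothing is lost compared with random vectors on an arbitrary probability space,
  whereas quantifying over that space would tie the constants to its type: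
\<close>

definition sample_space :: "nat \<Rightarrow> (nat \<Rightarrow> real) measure \<Rightarrow> (nat \<Rightarrow> nat \<Rightarrow> real) measure" where
  "sample_space m \<mu> = (\<Pi>\<^sub>M i\<in>{..<m}. \<mu>)"

lemma (in prob_space) prob_independent_copies:
  assumes "m \<ge> 1" and law: "\<And>i. i < m \<Longrightarrow> distr M (euc d) (X i) = \<mu>"
    and rv: "\<And>i. i < m \<Longrightarrow> random_variable (euc d) (X i)"
    and indep: "indep_vars (\<lambda>_. euc d) X {..<m}"
    and A: "A \<in> sets (sample_space m \<mu>)"
  shows "prob {\<omega> \<in> space M. (\<lambda>i\<in>{..<m}. X i \<omega>) \<in> A} = measure (sample_space m \<mu>) A"
proof -
  have ne: "{..<m} \<noteq> {}" using \<open>m \<ge> 1\<close> by (auto simp: lessThan_empty_iff)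
  have "sets \<mu> = sets (euc d)" using law[of 0] \<open>m \<ge> 1\<close> by auto
  then have sets: "sets (sample_space m \<mu>) = sets (\<Pi>\<^sub>M i\<in>{..<m}. euc d)"
    unfolding sample_space_def by (intro sets_PiM_cong) auto
  have "distr M (\<Pi>\<^sub>M i\<in>{..<m}. euc d) (\<lambda>\<omega>. \<lambda>i\<in>{..<m}. X i \<omega>)
      = (\<Pi>\<^sub>M i\<in>{..<m}. distr M (euc d) (X i))"
    using indep_vars_iff_distr_eq_PiM'[OF ne, where M' = "\<lambda>_. euc d" and X = X] rv indep by auto
  also have "\<dots> = sample_space m \<mu>"
    unfolding sample_space_def by (intro PiM_cong) (auto simp: law)
  finally have "measure (sample_space m \<mu>) A
      = measure (distr M (\<Pi>\<^sub>M i\<in>{..<m}. euc d) (\<lambda>\<omega>. \<lambda>i\<in>{..<m}. X i \<omega>)) A" by simp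
  also have "\<dots> = prob ((\<lambda>\<omega>. \<lambda>i\<in>{..<m}. X i \<omega>) -` A \<inter> space M)"
    using A sets by (intro measure_distr measurable_restrict rv) auto
  finally show ?thesis by (simp add: vimage_def Int_def conj_commute)
qed

end

theory Submission
  imports Defs
begin

text \<open>
  Projecting onto a direction \<open>\<theta>\<close> and comparing means already bounds the sliced distance from below:
  a transport cost is at least the squared difference of the means, and for the direction of the
  sample mean this difference is the norm of the sample mean (\<open>norm_mean_le_SW2\<close>). It
  therefore suffices that \<open>\<parallel>X\<^sub>1 + \<dots> + X\<^sub>m\<parallel>\<close> is at least of order \<open>\<surd>(m d)\<close> with probability bounded
  away from zero.

  The second moment of this norm is exactly \<open>m d\<close>, by isotropy and independence, so by the
  Paley--Zygmund inequality it is enough that the first moment is also of order \<open>\<surd>(m d)\<close>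
  (\<open>expectation_norm_sum_ge\<close>). No moments beyond the second are available, so random signs are
  introduced. For every choice of signs, \<open>\<Sum>\<^sub>i \<plusminus> X\<^sub>i\<close> is a difference of two sub-sums, and the expected
  norm of a sub-sum is at most that of the full sum because the omitted terms are independent and
  centred. Averaging over the signs and applying Khintchine's inequality for fixed vectors
  (\<open>khintchine\<close>) gives \<open>2 E \<parallel>\<Sum>\<^sub>i X\<^sub>i\<parallel> \<ge> 9/16 E (\<Sum>\<^sub>i \<parallel>X\<^sub>i\<parallel>\<^sup>2)\<^sup>1\<^sup>/\<^sup>2\<close>, and the Cauchy--Schwarz inequality
  bounds the right-hand side below by \<open>9/16 \<beta> \<surd>(m d)\<close>.

  The event in the theorem involves an infimum over couplings and a supremum over uncountably many
  directions, so its measurability is a separate matter (\<open>SW2_empirical_measurable\<close>). For a fixed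
  direction the distance is lower semicontinuous in the sample: moving each sample point by at most
  \<open>\<epsilon>\<close> changes the distance by at most \<open>\<epsilon>\<close> (\<open>W2_perturb\<close>). A supremum of lower semicontinuous
  functions is lower semicontinuous, hence Borel.
\<close>

section \<open>Moment inequalities\<close>

lemma (in prob_space) square_expectation_le:
  fixes f :: "'a \<Rightarrow> real"
  assumes "f \<in> borel_measurable M" and "integrable M (\<lambda>x. (f x)\<^sup>2)"
  shows "(expectation f)\<^sup>2 \<le> expectation (\<lambda>x. (f x)\<^sup>2)"
  using variance_eq[of f] variance_positive[of f] square_integrable_imp_integrable[OF assms] assms
  by simp

lemma L2_set_sum_squares: "(L2_set f A)\<^sup>2 = (\<Sum>i\<in>A. (f i)\<^sup>2)"
  by (simp add: L2_set_def sum_nonneg)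

lemma inner_le_L2_set: "(\<Sum>i\<in>A. u i * v i) \<le> L2_set u A * L2_set v A"
proof -
  have "(\<Sum>i\<in>A. u i * v i) \<le> (\<Sum>i\<in>A. \<bar>u i\<bar> * \<bar>v i\<bar>)"
    by (intro sum_mono) (simp add: abs_mult[symmetric])
  then show ?thesis using L2_set_mult_ineq[of u v A] by linarith
qed

text \<open>
  A variable whose mean is comparable to the root of its second moment is bounded below with
  positive probability: the part of the mean carried by \<open>{Z \<ge> a / 2}\<close> is at least \<open>a / 2\<close>, and
  it is controlled by the second moment and the probability of that event.
\<close>

lemma (in prob_space) paley_zygmund:
  fixes Z :: "'a \<Rightarrow> real"
  assumes [measurable]: "Z \<in> borel_measurable M" and Z2: "integrable M (\<lambda>\<omega>. (Z \<omega>)\<^sup>2)"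
    and a: "a > 0" "a \<le> expectation Z" and b: "b > 0" "expectation (\<lambda>\<omega>. (Z \<omega>)\<^sup>2) \<le> b"
  shows "prob {\<omega>\<in>space M. a / 2 \<le> Z \<omega>} \<ge> a\<^sup>2 / (4 * b)"
proof -
  let ?A = "{\<omega>\<in>space M. a / 2 \<le> Z \<omega>}"
  have A: "?A \<in> events" by measurable
  have IA: "integrable M (indicator ?A :: 'a \<Rightarrow> real)"
    using A by (intro integrable_real_indicator) (auto simp: emeasure_eq_measure)
  have Z1: "integrable M Z" by (rule square_integrable_imp_integrable) (use Z2 in auto)
  \<comment> \<open>On the event this is the inequality \<open>z \<le> \<lambda> z\<^sup>2 / 2 + 1 / (2 \<lambda>)\<close>; the value
    \<open>\<lambda> = a / (2 b)\<close> gives the best bound on the probability.\<close>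
  have pw: "Z \<omega> \<le> a / 2 + (a / (4 * b) * (Z \<omega>)\<^sup>2 + b / a * indicator ?A \<omega>)" if "\<omega> \<in> space M" for \<omega>
  proof (cases "a / 2 \<le> Z \<omega>")
    case True
    have "0 \<le> (a * Z \<omega> - 2 * b)\<^sup>2 / (4 * a * b)" using a b by simp
    also have "\<dots> = a / (4 * b) * (Z \<omega>)\<^sup>2 + b / a - Z \<omega>"
      using a b by (simp add: power2_eq_square field_simps)
    finally show ?thesis using True that a by simp
  next
    case False
    have "0 \<le> a / (4 * b) * (Z \<omega>)\<^sup>2" using a b by simp
    then show ?thesis using False by (simp add: indicator_def)
  qed
  have "a \<le> expectation Z" by fact
  also have "\<dots> \<le> expectation (\<lambda>\<omega>. a / 2 + (a / (4 * b) * (Z \<omega>)\<^sup>2 + b / a * indicator ?A \<omega>))"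
    by (intro integral_mono Z1 pw Bochner_Integration.integrable_add integrable_mult_right IA Z2 integrable_const)
  also have "\<dots> = a / 2 + (a / (4 * b) * expectation (\<lambda>\<omega>. (Z \<omega>)\<^sup>2) + b / a * prob ?A)"
    using A Z2 IA by (simp add: prob_space)
  also have "\<dots> \<le> a / 2 + (a / (4 * b) * b + b / a * prob ?A)"
    using a b by (intro add_mono mult_left_mono) auto
  also have "\<dots> = a / 2 + (a / 4 + b / a * prob ?A)"
    using b by simp
  finally have "a / 4 \<le> b / a * prob ?A" by linarith
  then show ?thesis using a b by (simp add: field_simps power2_eq_square)
qed

section \<open>Random signs\<close>

text \<open>
  A choice of signs for a family indexed by \<open>A\<close> is encoded by the set \<open>I \<subseteq> A\<close> of indices with
  sign \<open>+1\<close>, so that averages over random signs are finite sums over \<open>Pow A\<close>.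
\<close>

definition signed_sum :: "'i set \<Rightarrow> 'i set \<Rightarrow> ('i \<Rightarrow> 'j \<Rightarrow> real) \<Rightarrow> 'j \<Rightarrow> real" where
  "signed_sum A I x j = (\<Sum>i\<in>A. if i \<in> I then x i j else - x i j)"

lemma sum_Pow_insert:
  assumes "finite A" "a \<notin> A"
  shows "(\<Sum>I\<in>Pow (insert a A). f I) = (\<Sum>I\<in>Pow A. f I + f (insert a I) :: 'b::comm_monoid_add)"
proof -
  have "(\<Sum>I\<in>Pow (insert a A). f I) = (\<Sum>I\<in>Pow A. f I) + (\<Sum>I\<in>insert a ` Pow A. f I)"
    unfolding Pow_insert using assms by (intro sum.union_disjoint) auto
  also have "(\<Sum>I\<in>insert a ` Pow A. f I) = (\<Sum>I\<in>Pow A. f (insert a I))"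
    using assms by (subst sum.reindex) (auto simp: inj_on_def)
  finally show ?thesis by (simp add: sum.distrib)
qed

lemma signed_sum_insert:
  assumes "finite A" "a \<notin> A" "I \<subseteq> A"
  shows "signed_sum (insert a A) I x j = signed_sum A I x j - x a j"
    and "signed_sum (insert a A) (insert a I) x j = signed_sum A I x j + x a j"
proof -
  show "signed_sum (insert a A) I x j = signed_sum A I x j - x a j"
    using assms by (auto simp: signed_sum_def)
  have "(\<Sum>i\<in>A. if i \<in> insert a I then x i j else - x i j) = (\<Sum>i\<in>A. if i \<in> I then x i j else - x i j)"
    using assms by (intro sum.cong) auto
  then show "signed_sum (insert a A) (insert a I) x j = signed_sum A I x j + x a j"
    using assms by (simp add: signed_sum_def)
qed

lemma L2_set_add_sq:
  "(L2_set (\<lambda>j. u j + v j) B)\<^sup>2 = (L2_set u B)\<^sup>2 + 2 * (\<Sum>j\<in>B. u j * v j) + (L2_set v B)\<^sup>2"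
  "(L2_set (\<lambda>j. u j - v j) B)\<^sup>2 = (L2_set u B)\<^sup>2 - 2 * (\<Sum>j\<in>B. u j * v j) + (L2_set v B)\<^sup>2"
  unfolding L2_set_sum_squares
  by (simp_all add: power2_sum power2_diff sum.distrib sum_subtractf sum_distrib_left algebra_simps)

lemma signed_sum_second_moment:
  assumes "finite A"
  shows "(\<Sum>I\<in>Pow A. (L2_set (signed_sum A I x) B)\<^sup>2) = 2 ^ card A * (\<Sum>i\<in>A. (L2_set (x i) B)\<^sup>2)"
  using assms
proof (induction A)
  case empty
  then show ?case by (simp add: signed_sum_def L2_set_def)
next
  case (insert a A)
  have "(\<Sum>I\<in>Pow (insert a A). (L2_set (signed_sum (insert a A) I x) B)\<^sup>2)
      = (\<Sum>I\<in>Pow A. 2 * (L2_set (signed_sum A I x) B)\<^sup>2 + 2 * (L2_set (x a) B)\<^sup>2)"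
    unfolding sum_Pow_insert[OF insert.hyps] 
    by (intro sum.cong refl) (simp add: signed_sum_insert[OF insert.hyps] L2_set_add_sq cong: L2_set_cong)
  then show ?case
    using insert by (simp add: sum.distrib sum_distrib_left[symmetric] card_Pow algebra_simps)
qed

text \<open>
  One more random sign maps \<open>u\<close> to \<open>u + v\<close> or \<open>u - v\<close>. In the average of the two fourth
  powers of norms the odd powers of the inner product cancel, and its square is at most
  \<open>\<parallel>u\<parallel>\<^sup>2 \<parallel>v\<parallel>\<^sup>2\<close>. The resulting cross term \<open>6 \<parallel>u\<parallel>\<^sup>2 \<parallel>v\<parallel>\<^sup>2\<close> is the one in
  \<open>3 (\<parallel>u\<parallel>\<^sup>2 + \<parallel>v\<parallel>\<^sup>2)\<^sup>2\<close>, which is why the constant \<open>3\<close> survives the induction.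
\<close>

lemma signed_sum_fourth_moment:
  assumes "finite A"
  shows "(\<Sum>I\<in>Pow A. (L2_set (signed_sum A I x) B)^4) \<le> 3 * 2 ^ card A * (\<Sum>i\<in>A. (L2_set (x i) B)\<^sup>2)\<^sup>2"
  using assms
proof (induction A)
  case empty
  then show ?case by (simp add: signed_sum_def L2_set_def)
next
  case (insert a A)
  let ?q = "\<lambda>I. (L2_set (signed_sum A I x) B)\<^sup>2" and ?b = "(L2_set (x a) B)\<^sup>2"
    and ?S = "\<Sum>i\<in>A. (L2_set (x i) B)\<^sup>2"
  have pair: "(L2_set (\<lambda>j. u j - v j) B)^4 + (L2_set (\<lambda>j. u j + v j) B)^4
      \<le> 2 * (L2_set u B)^4 + 12 * (L2_set u B)\<^sup>2 * (L2_set v B)\<^sup>2 + 2 * (L2_set v B)^4" for u v :: "_ \<Rightarrow> real"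
  proof -
    let ?p = "\<Sum>j\<in>B. u j * v j"
    have "?p\<^sup>2 \<le> (L2_set u B)\<^sup>2 * (L2_set v B)\<^sup>2"
      unfolding L2_set_sum_squares by (rule Cauchy_Schwarz_ineq_sum)
    moreover have "(L2_set (\<lambda>j. u j - v j) B)^4 + (L2_set (\<lambda>j. u j + v j) B)^4
      = ((L2_set (\<lambda>j. u j - v j) B)\<^sup>2)\<^sup>2 + ((L2_set (\<lambda>j. u j + v j) B)\<^sup>2)\<^sup>2" by simp
    moreover have "\<dots> = 2 * ((L2_set u B)\<^sup>2 + (L2_set v B)\<^sup>2)\<^sup>2 + 8 * ?p\<^sup>2"
      unfolding L2_set_add_sq by algebra
    moreover have "\<dots> = 2 * (L2_set u B)^4 + 4 * ((L2_set u B)\<^sup>2 * (L2_set v B)\<^sup>2) + 2 * (L2_set v B)^4 + 8 * ?p\<^sup>2"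
      by algebra
    ultimately show ?thesis by linarith
  qed
  have "(\<Sum>I\<in>Pow (insert a A). (L2_set (signed_sum (insert a A) I x) B)^4)
      \<le> (\<Sum>I\<in>Pow A. 2 * (L2_set (signed_sum A I x) B)^4 + 12 * ?q I * ?b + 2 * (L2_set (x a) B)^4)"
    unfolding sum_Pow_insert[OF insert.hyps]
    by (intro sum_mono) (use pair in \<open>simp add: signed_sum_insert[OF insert.hyps] cong: L2_set_cong\<close>)
  also have "\<dots> = 2 * (\<Sum>I\<in>Pow A. (L2_set (signed_sum A I x) B)^4) + 12 * (\<Sum>I\<in>Pow A. ?q I) * ?b + 2 ^ card A * 2 * ?b\<^sup>2"
    using insert.hyps by (simp add: sum.distrib sum_distrib_left sum_distrib_right card_Pow)
  also have "\<dots> \<le> 2 * (3 * 2 ^ card A * ?S\<^sup>2) + 12 * (2 ^ card A * ?S) * ?b + 2 ^ card A * 6 * ?b\<^sup>2"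
    using insert by (intro add_mono mult_left_mono mult_right_mono) (auto simp: signed_sum_second_moment)
  also have "\<dots> = 3 * 2 ^ card (insert a A) * (\<Sum>i\<in>insert a A. (L2_set (x i) B)\<^sup>2)\<^sup>2"
    using insert.hyps by (simp add: power2_eq_square algebra_simps)
  finally show ?case .
qed

text \<open>
  The first moment of a random signed sum is bounded below by its second and fourth moments, by
  averaging a polynomial that lies below the identity on \<open>r \<ge> 0\<close>. After rescaling so that the
  second moment is \<open>1\<close>, the polynomial \<open>3/4 r\<^sup>2 - r\<^sup>4 / 16\<close> has mean at least
  \<open>3/4 - 3/16 = 9/16\<close>.
\<close>

lemma khintchine:
  assumes "finite A"
  shows "9 / 16 * sqrt (\<Sum>i\<in>A. (L2_set (x i) B)\<^sup>2) \<le> (\<Sum>I\<in>Pow A. L2_set (signed_sum A I x) B) / 2 ^ card A"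
proof (cases "(\<Sum>i\<in>A. (L2_set (x i) B)\<^sup>2) = 0")
  case True
  then show ?thesis by (simp add: sum_nonneg)
next
  case False
  define V where "V = (\<Sum>i\<in>A. (L2_set (x i) B)\<^sup>2)"
  have V: "V > 0" using False unfolding V_def by (simp add: sum_nonneg less_le)
  define \<sigma> where "\<sigma> = sqrt V"
  have \<sigma>: "\<sigma> > 0" "\<sigma>\<^sup>2 = V" using V by (auto simp: \<sigma>_def)
  \<comment> \<open>With \<open>\<sigma> = 1\<close> the gap is \<open>r (r - 2)\<^sup>2 (r + 4) / 16\<close>.\<close>
  have pw: "3 / 4 * r\<^sup>2 / \<sigma> - r^4 / (16 * \<sigma>^3) \<le> r" if "r \<ge> 0" for r :: real
  proof -
    have "0 \<le> r * (r - 2 * \<sigma>)\<^sup>2 * (r + 4 * \<sigma>) / (16 * \<sigma>^3)" using that \<sigma> by simp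
    also have "\<dots> = r - (3 / 4 * r\<^sup>2 / \<sigma> - r^4 / (16 * \<sigma>^3))"
      using \<sigma>(1) by (simp add: field_simps power2_eq_square power3_eq_cube power4_eq_xxxx)
    finally show ?thesis by simp
  qed
  have "9 / 16 * \<sigma> * 2 ^ card A = 3 / 4 * (2 ^ card A * \<sigma>\<^sup>2) / \<sigma> - 3 * 2 ^ card A * (\<sigma>\<^sup>2)\<^sup>2 / (16 * \<sigma>^3)"
    using \<sigma>(1) by (simp add: field_simps power2_eq_square power3_eq_cube)
  also have "\<dots> \<le> 3 / 4 * (\<Sum>I\<in>Pow A. (L2_set (signed_sum A I x) B)\<^sup>2) / \<sigma>
      - (\<Sum>I\<in>Pow A. (L2_set (signed_sum A I x) B)^4) / (16 * \<sigma>^3)"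
    using signed_sum_fourth_moment[OF assms, of x B] \<sigma>
    unfolding signed_sum_second_moment[OF assms] \<sigma>(2) V_def[symmetric]
    by (intro diff_mono divide_right_mono) auto
  also have "\<dots> = (\<Sum>I\<in>Pow A. 3 / 4 * (L2_set (signed_sum A I x) B)\<^sup>2 / \<sigma> - (L2_set (signed_sum A I x) B)^4 / (16 * \<sigma>^3))"
    by (simp add: sum_subtractf sum_distrib_left sum_divide_distrib)
  also have "\<dots> \<le> (\<Sum>I\<in>Pow A. L2_set (signed_sum A I x) B)"
    by (intro sum_mono pw) simp
  finally show ?thesis by (simp add: \<sigma>_def V_def field_simps)
qed

section \<open>Sums of independent isotropic vectors\<close>

locale isotropic_law =
  fixes d :: nat and \<mu> :: "(nat \<Rightarrow> real) measure"
  assumes law: "prob_law d \<mu>" and cent: "centred d \<mu>" and iso: "isotropic d \<mu>"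

sublocale isotropic_law \<subseteq> prob_space \<mu>
  using law by (simp add: prob_law_def)

context isotropic_law
begin

lemma sets_law [measurable_cong]: "sets \<mu> = sets (euc d)"
  using law by (simp add: prob_law_def)

lemma coordinate_measurable: "j < d \<Longrightarrow> (\<lambda>x. x j) \<in> borel_measurable \<mu>"
  unfolding measurable_cong_sets[OF sets_law refl] euc_def
  by (intro measurable_component_singleton) simp

lemma norm_measurable [measurable]: "(\<lambda>x. L2_set x {..<d}) \<in> borel_measurable \<mu>"
  unfolding L2_set_def
  by (intro borel_measurable_sqrt[THEN measurable_compose[rotated]] borel_measurable_sum borel_measurable_power coordinate_measurable) auto

lemma coordinate_moments:
  assumes "j < d"
  shows "integrable \<mu> (\<lambda>x. x j)" "expectation (\<lambda>x. x j) = 0"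
    "integrable \<mu> (\<lambda>x. (x j)\<^sup>2)" "expectation (\<lambda>x. (x j)\<^sup>2) = 1"
proof -
  show "integrable \<mu> (\<lambda>x. x j)" "integrable \<mu> (\<lambda>x. (x j)\<^sup>2)" and E: "expectation (\<lambda>x. x j) = 0"
    using cent iso assms by (auto simp: centred_def isotropic_def)
  have "covariance \<mu> j j = 1" using iso assms by (auto simp: isotropic_def)
  then show "expectation (\<lambda>x. (x j)\<^sup>2) = 1"
    by (simp add: covariance_def E power2_eq_square)
qed

lemma norm_integrable: "integrable \<mu> (\<lambda>x. L2_set x {..<d})"
  by (rule square_integrable_imp_integrable)
    (auto simp: L2_set_sum_squares intro!: Bochner_Integration.integrable_sum coordinate_moments)

end

locale isotropic_sample = isotropic_law +
  fixes m :: nat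
  assumes m: "m \<ge> 1"
begin

definition P :: "(nat \<Rightarrow> nat \<Rightarrow> real) measure" where
  "P = sample_space m \<mu>"

lemma P_eq: "P = (\<Pi>\<^sub>M i\<in>{..<m}. \<mu>)" by (simp add: P_def sample_space_def)

sublocale P: prob_space P
  unfolding P_eq by (intro prob_space_PiM prob_space_axioms)

lemma proj_measurable: "i < m \<Longrightarrow> (\<lambda>x. x i) \<in> P \<rightarrow>\<^sub>M \<mu>"
  unfolding P_eq by (intro measurable_component_singleton) simp

lemma distr_proj: "i < m \<Longrightarrow> distr P \<mu> (\<lambda>x. x i) = \<mu>"
  unfolding P_eq by (intro distr_PiM_component prob_space_axioms) simp

lemma entry_measurable: "i < m \<Longrightarrow> j < d \<Longrightarrow> (\<lambda>x. x i j) \<in> borel_measurable P"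
  using measurable_compose[OF proj_measurable coordinate_measurable] .

lemma integral_proj:
  fixes f :: "(nat \<Rightarrow> real) \<Rightarrow> real"
  assumes "i < m" and "f \<in> borel_measurable \<mu>"
  shows "P.expectation (\<lambda>x. f (x i)) = expectation f"
    and "integrable P (\<lambda>x. f (x i)) \<longleftrightarrow> integrable \<mu> f"
  using integral_distr[OF proj_measurable[OF assms(1)] assms(2)]
    integrable_distr_eq[OF proj_measurable[OF assms(1)] assms(2)]
  unfolding distr_proj[OF assms(1)] by simp_all

lemma entry_moments:
  assumes "i < m" "j < d"
  shows "integrable P (\<lambda>x. x i j)" "P.expectation (\<lambda>x. x i j) = 0"
    "integrable P (\<lambda>x. (x i j)\<^sup>2)" "P.expectation (\<lambda>x. (x i j)\<^sup>2) = 1"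
  using integral_proj[OF assms(1) coordinate_measurable[OF assms(2)]]
    integral_proj[OF assms(1) borel_measurable_power[OF coordinate_measurable[OF assms(2)], where n = 2]]
    coordinate_moments[OF assms(2)]
  by simp_all

lemma indep_proj: "P.indep_vars (\<lambda>_. \<mu>) (\<lambda>i x. x i) {..<m}"
proof (subst P.indep_vars_iff_distr_eq_PiM')
  show "{..<m} \<noteq> {}" using m by (auto simp: lessThan_empty_iff)
  have "distr P (\<Pi>\<^sub>M i\<in>{..<m}. \<mu>) (\<lambda>x. \<lambda>i\<in>{..<m}. x i) = distr P P (\<lambda>x. x)"
    unfolding P_eq by (intro distr_cong) (auto simp: space_PiM)
  also have "\<dots> = P" by simp
  also have "\<dots> = (\<Pi>\<^sub>M i\<in>{..<m}. distr P \<mu> (\<lambda>x. x i))"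
    unfolding P_eq by (intro PiM_cong) (simp_all add: distr_proj[unfolded P_eq])
  finally show "distr P (\<Pi>\<^sub>M i\<in>{..<m}. \<mu>) (\<lambda>x. \<lambda>i\<in>{..<m}. x i) = (\<Pi>\<^sub>M i\<in>{..<m}. distr P \<mu> (\<lambda>x. x i))" .
qed (use proj_measurable in auto)

lemma indep_blocks:
  assumes "I \<subseteq> {..<m}" "K \<subseteq> {..<m}" "I \<inter> K = {}"
    and "f \<in> borel_measurable (\<Pi>\<^sub>M i\<in>I. \<mu>)" "g \<in> borel_measurable (\<Pi>\<^sub>M i\<in>K. \<mu>)"
  shows "P.indep_var borel (\<lambda>x. f (restrict x I)) borel (\<lambda>x. g (restrict x K))"
  using P.indep_var_compose[OF P.indep_var_restrict[OF indep_proj assms(3,1,2)] assms(4,5)]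
  by (simp add: comp_def)

text \<open>
  Sums over blocks of sample indices are functions of the whole sample that depend only on the
  block; disjoint blocks therefore give independent sums.
\<close>

definition block_sum :: "nat set \<Rightarrow> (nat \<Rightarrow> nat \<Rightarrow> real) \<Rightarrow> nat \<Rightarrow> real" where
  "block_sum I x j = (\<Sum>i\<in>I. x i j)"

lemma block_sum_measurable:
  assumes "I \<subseteq> {..<m}" "j < d"
  shows "(\<lambda>x. block_sum I x j) \<in> borel_measurable P"
  unfolding block_sum_def using assms by (intro borel_measurable_sum entry_measurable) auto

lemma block_sum_PiM_measurable:
  assumes "j < d"
  shows "(\<lambda>x. block_sum I x j) \<in> borel_measurable (\<Pi>\<^sub>M i\<in>I. \<mu>)"
  unfolding block_sum_def
proof (intro borel_measurable_sum)
  fix i assume "i \<in> I"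
  then have "(\<lambda>x. x i) \<in> (\<Pi>\<^sub>M i\<in>I. \<mu>) \<rightarrow>\<^sub>M \<mu>" by (rule measurable_component_singleton)
  from measurable_compose[OF this coordinate_measurable[OF assms]]
  show "(\<lambda>x. x i j) \<in> borel_measurable (\<Pi>\<^sub>M i\<in>I. \<mu>)" .
qed

lemma block_norm_measurable:
  assumes "I \<subseteq> {..<m}"
  shows "(\<lambda>x. L2_set (block_sum I x) {..<d}) \<in> borel_measurable P"
  unfolding L2_set_def
  by (intro borel_measurable_sqrt[THEN measurable_compose[rotated]] borel_measurable_sum borel_measurable_power
      block_sum_measurable assms) auto

lemma block_norm_PiM_measurable:
  "(\<lambda>x. L2_set (block_sum I x) {..<d}) \<in> borel_measurable (\<Pi>\<^sub>M i\<in>I. \<mu>)"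
  unfolding L2_set_def
  by (intro borel_measurable_sqrt[THEN measurable_compose[rotated]] borel_measurable_sum borel_measurable_power
      block_sum_PiM_measurable) auto

lemma entry_uncorrelated:
  assumes "i < m" "k < m" "i \<noteq> k" "j < d"
  shows "integrable P (\<lambda>x. x i j * x k j)" "P.expectation (\<lambda>x. x i j * x k j) = 0"
proof -
  have ind': "P.indep_var borel (\<lambda>x. x i j) borel (\<lambda>x. x k j)"
    using indep_blocks[of "{i}" "{k}", OF _ _ _ block_sum_PiM_measurable block_sum_PiM_measurable, OF _ _ _ assms(4) assms(4)] assms
    by (simp add: block_sum_def)
  show "integrable P (\<lambda>x. x i j * x k j)"
    using P.indep_var_integrable[OF ind'] entry_moments assms by simp
  show "P.expectation (\<lambda>x. x i j * x k j) = 0"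
    using P.indep_var_lebesgue_integral[OF ind'] entry_moments assms by simp
qed

lemma block_sum_square:
  assumes I: "I \<subseteq> {..<m}" and j: "j < d"
  shows "integrable P (\<lambda>x. (block_sum I x j)\<^sup>2)" "P.expectation (\<lambda>x. (block_sum I x j)\<^sup>2) = real (card I)"
proof -
  have fin: "finite I" using I finite_subset by blast
  have int: "integrable P (\<lambda>x. x i j * x k j)"
    and E: "P.expectation (\<lambda>x. x i j * x k j) = (if i = k then 1 else 0)" if "i \<in> I" "k \<in> I" for i k
    using that I j entry_uncorrelated[of i k j] entry_moments[of i j] by (auto simp: power2_eq_square)
  have eq: "(block_sum I x j)\<^sup>2 = (\<Sum>i\<in>I. \<Sum>k\<in>I. x i j * x k j)" for x
    by (simp add: block_sum_def power2_eq_square sum_product)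
  show "integrable P (\<lambda>x. (block_sum I x j)\<^sup>2)"
    unfolding eq by (intro Bochner_Integration.integrable_sum int)
  have "P.expectation (\<lambda>x. (block_sum I x j)\<^sup>2) = (\<Sum>i\<in>I. \<Sum>k\<in>I. P.expectation (\<lambda>x. x i j * x k j))"
    unfolding eq by (simp add: Bochner_Integration.integral_sum Bochner_Integration.integrable_sum int)
  also have "\<dots> = (\<Sum>i\<in>I. \<Sum>k\<in>I. if i = k then 1 else 0)" by (intro sum.cong refl E)
  also have "\<dots> = real (card I)" using fin by simp
  finally show "P.expectation (\<lambda>x. (block_sum I x j)\<^sup>2) = real (card I)" .
qed

lemma block_norm_square:
  assumes I: "I \<subseteq> {..<m}"
  shows "integrable P (\<lambda>x. (L2_set (block_sum I x) {..<d})\<^sup>2)"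
    "P.expectation (\<lambda>x. (L2_set (block_sum I x) {..<d})\<^sup>2) = real d * real (card I)"
  unfolding L2_set_sum_squares
  using block_sum_square[OF I] by (auto simp: Bochner_Integration.integral_sum intro!: Bochner_Integration.integrable_sum)

lemma block_norm_integrable:
  assumes "I \<subseteq> {..<m}"
  shows "integrable P (\<lambda>x. L2_set (block_sum I x) {..<d})"
  using P.square_integrable_imp_integrable[OF block_norm_measurable block_norm_square(1)] assms by simp

text \<open>
  Adding an independent centred vector cannot decrease the expected norm. The norm is convex with
  subgradient \<open>u / \<parallel>u\<parallel>\<close> at \<open>u\<close>, so \<open>\<parallel>u + v\<parallel> \<ge> \<parallel>u\<parallel> + \<langle>u / \<parallel>u\<parallel>, v\<rangle>\<close>, and the last term has mean
  zero when \<open>v\<close> is centred and independent of \<open>u\<close>.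
\<close>

lemma block_norm_mono:
  assumes I: "I \<subseteq> {..<m}"
  shows "P.expectation (\<lambda>x. L2_set (block_sum I x) {..<d}) \<le> P.expectation (\<lambda>x. L2_set (block_sum {..<m} x) {..<d})"
proof -
  define K where "K = {..<m} - I"
  have K: "K \<subseteq> {..<m}" "I \<inter> K = {}" by (auto simp: K_def)
  \<comment> \<open>The subgradient; division by zero makes it vanish where the block sum does.\<close>
  define g where "g j x = block_sum I x j / L2_set (block_sum I x) {..<d}" for j x
  have g_meas: "g j \<in> borel_measurable (\<Pi>\<^sub>M i\<in>I. \<mu>)" if "j < d" for j
    unfolding g_def[abs_def] by (intro borel_measurable_divide block_sum_PiM_measurable block_norm_PiM_measurable that)
  have restr: "block_sum J (restrict x J) = block_sum J x" for J x by (simp add: block_sum_def fun_eq_iff)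
  have ind: "P.indep_var borel (g j) borel (\<lambda>x. block_sum K x j)" if j: "j < d" for j
    using indep_blocks[OF I K g_meas[OF j] block_sum_PiM_measurable[OF j]]
    by (simp add: g_def[abs_def] restr)
  have bound: "\<bar>g j x\<bar> \<le> 1" if "j < d" for j x
  proof -
    have "\<bar>block_sum I x j\<bar> \<le> L2_set (block_sum I x) {..<d}"
      using that member_le_L2_set[of "{..<d}" j "\<lambda>j. \<bar>block_sum I x j\<bar>"] by (simp add: L2_set_def)
    then show ?thesis by (auto simp: g_def divide_le_eq_1 less_le)
  qed
  have g_int: "integrable P (g j)" if j: "j < d" for j
  proof (rule P.integrable_const_bound[where B = 1])
    show "g j \<in> borel_measurable P" using P.indep_var_rv1[OF ind[OF j]] by simp
  qed (use bound[OF j] in auto)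
  have K_int: "integrable P (\<lambda>x. block_sum K x j)" if "j < d" for j
    unfolding block_sum_def using K that by (intro Bochner_Integration.integrable_sum entry_moments) auto
  have K_E: "P.expectation (\<lambda>x. block_sum K x j) = 0" if "j < d" for j
    unfolding block_sum_def using K that entry_moments
    by (subst Bochner_Integration.integral_sum) (auto intro!: sum.neutral)
  have prod_int: "integrable P (\<lambda>x. g j x * block_sum K x j)"
    and prod_E: "P.expectation (\<lambda>x. g j x * block_sum K x j) = 0" if j: "j < d" for j
    using P.indep_var_integrable[OF ind[OF j] g_int[OF j] K_int[OF j]]
      P.indep_var_lebesgue_integral[OF ind[OF j] g_int[OF j] K_int[OF j]] K_E[OF j] by simp_all
  have pw: "L2_set (block_sum I x) {..<d} + (\<Sum>j<d. g j x * block_sum K x j) \<le> L2_set (block_sum {..<m} x) {..<d}" for x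
  proof -
    let ?u = "block_sum I x" and ?v = "block_sum K x" and ?w = "block_sum {..<m} x"
    let ?n = "L2_set ?u {..<d}"
    have "?w j = ?u j + ?v j" for j
      using I unfolding block_sum_def K_def by (subst sum.subset_diff[of I "{..<m}"]) auto
    then have w: "?w = (\<lambda>j. ?u j + ?v j)" by auto
    show ?thesis
    proof (cases "?n = 0")
      case True
      then show ?thesis by (simp add: g_def)
    next
      case False
      then have n: "?n > 0" by (simp add: less_le)
      have "?n * (?n + (\<Sum>j<d. g j x * ?v j)) = ?n\<^sup>2 + (\<Sum>j<d. ?u j * ?v j)"
        using n by (simp add: g_def sum_divide_distrib[symmetric] power2_eq_square distrib_left)
      also have "\<dots> = (\<Sum>j<d. ?u j * ?w j)"
        unfolding L2_set_sum_squares by (simp add: w sum.distrib distrib_left power2_eq_square)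
      also have "\<dots> \<le> ?n * L2_set ?w {..<d}" by (rule inner_le_L2_set)
      finally show ?thesis using n by simp
    qed
  qed
  have sum_int: "integrable P (\<lambda>x. \<Sum>j<d. g j x * block_sum K x j)"
    by (intro Bochner_Integration.integrable_sum prod_int) simp
  have sum_E: "P.expectation (\<lambda>x. \<Sum>j<d. g j x * block_sum K x j) = 0"
    using prod_E by (subst Bochner_Integration.integral_sum) (auto intro: prod_int)
  have "P.expectation (\<lambda>x. L2_set (block_sum I x) {..<d})
      = P.expectation (\<lambda>x. L2_set (block_sum I x) {..<d} + (\<Sum>j<d. g j x * block_sum K x j))"
    using sum_E by (subst Bochner_Integration.integral_add[OF block_norm_integrable[OF I] sum_int]) simp
  also have "\<dots> \<le> P.expectation (\<lambda>x. L2_set (block_sum {..<m} x) {..<d})"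
    by (intro integral_mono Bochner_Integration.integrable_add Bochner_Integration.integrable_sum
        block_norm_integrable I order_refl prod_int pw) simp
  finally show ?thesis .
qed

text \<open>
  For fixed signs the signed sum is the difference of the block of positive and the block of
  negative signs, and neither block has larger expected norm than the full sum.
\<close>

lemma signed_sum_expectation_le:
  assumes I: "I \<subseteq> {..<m}"
  shows "integrable P (\<lambda>x. L2_set (signed_sum {..<m} I x) {..<d})"
    "P.expectation (\<lambda>x. L2_set (signed_sum {..<m} I x) {..<d}) \<le> 2 * P.expectation (\<lambda>x. L2_set (block_sum {..<m} x) {..<d})"
proof -
  let ?K = "{..<m} - I"
  have eq: "signed_sum {..<m} I x = (\<lambda>j. block_sum I x j - block_sum ?K x j)" for x
    unfolding signed_sum_def block_sum_def fun_eq_iff using I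
    by (subst sum.If_cases) (auto simp: sum_negf Int_absorb1 Diff_eq)
  have pw: "L2_set (signed_sum {..<m} I x) {..<d} \<le> L2_set (block_sum I x) {..<d} + L2_set (block_sum ?K x) {..<d}" for x
    using L2_set_triangle_ineq[of "block_sum I x" "\<lambda>j. - block_sum ?K x j" "{..<d}"] unfolding eq
    by (simp add: L2_set_def)
  have meas: "(\<lambda>x. L2_set (signed_sum {..<m} I x) {..<d}) \<in> borel_measurable P"
    unfolding eq L2_set_def
    by (intro borel_measurable_sqrt[THEN measurable_compose[rotated]] borel_measurable_sum borel_measurable_power
      borel_measurable_diff block_sum_measurable I) auto
  have int: "integrable P (\<lambda>x. L2_set (block_sum I x) {..<d} + L2_set (block_sum ?K x) {..<d})"
    by (intro Bochner_Integration.integrable_add block_norm_integrable I) auto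
  show int': "integrable P (\<lambda>x. L2_set (signed_sum {..<m} I x) {..<d})"
    by (rule Bochner_Integration.integrable_bound[OF int meas]) (use pw in \<open>auto intro!: AE_I2\<close>)
  have "P.expectation (\<lambda>x. L2_set (signed_sum {..<m} I x) {..<d})
      \<le> P.expectation (\<lambda>x. L2_set (block_sum I x) {..<d} + L2_set (block_sum ?K x) {..<d})"
    by (intro integral_mono int int' pw)
  also have "\<dots> = P.expectation (\<lambda>x. L2_set (block_sum I x) {..<d}) + P.expectation (\<lambda>x. L2_set (block_sum ?K x) {..<d})"
    by (intro Bochner_Integration.integral_add block_norm_integrable I) auto
  also have "\<dots> \<le> 2 * P.expectation (\<lambda>x. L2_set (block_sum {..<m} x) {..<d})"
    using block_norm_mono[OF I] block_norm_mono[of ?K] by simp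
  finally show "P.expectation (\<lambda>x. L2_set (signed_sum {..<m} I x) {..<d}) \<le> 2 * P.expectation (\<lambda>x. L2_set (block_sum {..<m} x) {..<d})" .
qed

text \<open>
  The average over signs of the expected norms of the signed sums is at most twice the expected
  norm of the sum; by Khintchine's inequality it is, up to the factor \<open>9/16\<close>, at least the mean of
  \<open>(\<Sum>\<^sub>i \<parallel>X\<^sub>i\<parallel>\<^sup>2)\<^sup>1\<^sup>/\<^sup>2 \<ge> m\<^sup>-\<^sup>1\<^sup>/\<^sup>2 \<Sum>\<^sub>i \<parallel>X\<^sub>i\<parallel>\<close>.
\<close>

lemma expectation_norm_sum_ge:
  assumes \<beta>: "expectation (\<lambda>x. L2_set x {..<d}) \<ge> \<beta> * sqrt (real d)"
  shows "P.expectation (\<lambda>x. L2_set (block_sum {..<m} x) {..<d}) \<ge> 9 / 32 * \<beta> * sqrt (real m * real d)"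
proof -
  let ?A = "{..<m}"
  let ?k = "\<lambda>x. (\<Sum>I\<in>Pow ?A. L2_set (signed_sum ?A I x) {..<d}) / 2 ^ m"
  have pw: "9 / 16 * (\<Sum>i<m. L2_set (x i) {..<d}) / sqrt (real m) \<le> ?k x" for x
  proof -
    have "(\<Sum>i<m. L2_set (x i) {..<d})\<^sup>2 \<le> (\<Sum>i<m. (L2_set (x i) {..<d})\<^sup>2) * real m"
      using sum_squared_le_sum_of_squares[of "\<lambda>i. L2_set (x i) {..<d}" ?A] by simp
    then have "(\<Sum>i<m. L2_set (x i) {..<d}) \<le> sqrt ((\<Sum>i<m. (L2_set (x i) {..<d})\<^sup>2) * real m)"
      by (rule real_le_rsqrt)
    then have "(\<Sum>i<m. L2_set (x i) {..<d}) / sqrt (real m) \<le> sqrt (\<Sum>i<m. (L2_set (x i) {..<d})\<^sup>2)"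
      using m by (simp add: real_sqrt_mult divide_le_eq)
    then have "9 / 16 * ((\<Sum>i<m. L2_set (x i) {..<d}) / sqrt (real m))
        \<le> 9 / 16 * sqrt (\<Sum>i<m. (L2_set (x i) {..<d})\<^sup>2)"
      by (intro mult_left_mono) auto
    also have "\<dots> \<le> ?k x" using khintchine[of ?A x "{..<d}"] by simp
    finally show ?thesis by simp
  qed
  have int: "integrable P (\<lambda>x. L2_set (x i) {..<d})" "P.expectation (\<lambda>x. L2_set (x i) {..<d}) = expectation (\<lambda>x. L2_set x {..<d})"
    if "i < m" for i
    using integral_proj[OF that norm_measurable] norm_integrable by auto
  have "9 / 16 * \<beta> * sqrt (real m * real d) = 9 / 16 * (real m * (\<beta> * sqrt (real d))) / sqrt (real m)"
    using m by (simp add: real_sqrt_mult field_simps)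
  also have "\<dots> \<le> 9 / 16 * (real m * expectation (\<lambda>x. L2_set x {..<d})) / sqrt (real m)"
    using \<beta> by (intro divide_right_mono mult_left_mono) auto
  also have "\<dots> = P.expectation (\<lambda>x. 9 / 16 * (\<Sum>i<m. L2_set (x i) {..<d}) / sqrt (real m))"
    using int by (simp add: Bochner_Integration.integral_sum)
  also have "\<dots> \<le> P.expectation ?k"
    by (intro integral_mono pw integrable_divide_zero integrable_mult_right Bochner_Integration.integrable_sum int signed_sum_expectation_le) auto
  also have "\<dots> = (\<Sum>I\<in>Pow ?A. P.expectation (\<lambda>x. L2_set (signed_sum ?A I x) {..<d})) / 2 ^ m"
    using signed_sum_expectation_le by (simp add: Bochner_Integration.integral_sum)
  also have "\<dots> \<le> (\<Sum>I\<in>Pow ?A. 2 * P.expectation (\<lambda>x. L2_set (block_sum ?A x) {..<d})) / 2 ^ m"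
    by (intro divide_right_mono sum_mono signed_sum_expectation_le) auto
  also have "\<dots> = 2 * P.expectation (\<lambda>x. L2_set (block_sum ?A x) {..<d})"
    by (simp add: card_Pow)
  finally show ?thesis by simp
qed

lemma norm_sum_large:
  assumes d: "d \<ge> 1" and "\<beta> > 0" and \<beta>: "expectation (\<lambda>x. L2_set x {..<d}) \<ge> \<beta> * sqrt (real d)"
  shows "P.prob {x\<in>space P. 9 / 64 * \<beta> * sqrt (real m * real d) \<le> L2_set (block_sum {..<m} x) {..<d}} \<ge> (9 / 64 * \<beta>)\<^sup>2"
proof -
  let ?a = "9 / 32 * \<beta> * sqrt (real m * real d)" and ?b = "real m * real d"
  have b: "?b > 0" using d m by simp
  have "?a\<^sup>2 / (4 * ?b) \<le> P.prob {x\<in>space P. ?a / 2 \<le> L2_set (block_sum {..<m} x) {..<d}}"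
    using b expectation_norm_sum_ge[OF \<beta>] block_norm_square[of "{..<m}"] \<open>\<beta> > 0\<close> d m
    by (intro P.paley_zygmund block_norm_measurable) (auto simp: mult.commute)
  moreover have "?a\<^sup>2 / (4 * ?b) = (9 / 64 * \<beta>)\<^sup>2"
    using d m by (simp add: power_mult_distrib field_simps)
  ultimately show ?thesis by simp
qed

end

section \<open>Wasserstein distance to an empirical measure\<close>

text \<open>
  A coupling of an empirical measure with \<open>\<nu>\<close> knows the location of the first point but not
  which sample point it is, since sample points may coincide. This adds the missing label: given
  the location, the label is drawn uniformly among the indices sitting there. The labels are then
  uniform overall, and the sample points can be moved one by one while the second marginal is kept.
\<close>

lemma labelled_coupling:
  fixes b :: "nat \<Rightarrow> 'a::euclidean_space"
  assumes m: "m \<ge> 1" and \<gamma>: "\<gamma> \<in> couplings (distr (uniform_count_measure {..<m}) borel b) \<nu>"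
  obtains \<Lambda> :: "(('a \<times> 'a) \<times> nat) measure"
  where "sets \<Lambda> = sets ((borel \<Otimes>\<^sub>M borel) \<Otimes>\<^sub>M count_space {..<m})"
    and "distr \<Lambda> (borel \<Otimes>\<^sub>M borel) fst = \<gamma>"
    and "distr \<Lambda> (count_space {..<m}) snd = uniform_count_measure {..<m}"
    and "AE q in \<Lambda>. fst (fst q) = b (snd q)"
proof -
  let ?U = "uniform_count_measure {..<m}" and ?C = "count_space {..<m}"
  have sets\<gamma>: "sets \<gamma> = sets (borel \<Otimes>\<^sub>M borel)"
    and fst\<gamma>: "distr \<gamma> borel fst = distr ?U borel b"
    using \<gamma> by (auto simp: couplings_def)
  note [measurable_cong] = sets\<gamma>
  have [simp]: "space \<gamma> = UNIV"
    using sets_eq_imp_space_eq[OF sets\<gamma>] by (simp add: space_pair_measure)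
  interpret C: sigma_finite_measure ?C
    by (rule sigma_finite_measure_count_space_finite) simp
  have [measurable]: "b \<in> ?U \<rightarrow>\<^sub>M borel" "b \<in> ?C \<rightarrow>\<^sub>M borel"
    by (auto simp: measurable_def space_uniform_count_measure sets_uniform_count_measure)
  define N where "N i = card {j\<in>{..<m}. b j = b i}" for i
  have [measurable]: "(\<lambda>i. ennreal (1 / real (N i))) \<in> ?C \<rightarrow>\<^sub>M borel" by simp
  define w where "w = (\<lambda>q :: ('a \<times> 'a) \<times> nat.
    if fst (fst q) = b (snd q) then ennreal (1 / real (N (snd q))) else 0)"
  have [measurable]: "w \<in> borel_measurable (\<gamma> \<Otimes>\<^sub>M ?C)"
    unfolding w_def by measurable
  define \<Lambda> where "\<Lambda> = density (\<gamma> \<Otimes>\<^sub>M ?C) w"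
  have Npos: "N i > 0" if "i < m" for i
    using that by (auto simp: N_def card_gt_0_iff)
  have int: "(\<integral>\<^sup>+q. f q \<partial>\<Lambda>) = (\<integral>\<^sup>+p. (\<Sum>i<m. w (p, i) * f (p, i)) \<partial>\<gamma>)"
    if [measurable]: "f \<in> borel_measurable (\<gamma> \<Otimes>\<^sub>M ?C)" for f
    unfolding \<Lambda>_def by (simp add: nn_integral_density C.nn_integral_fst[symmetric] nn_integral_count_space_finite)
  show ?thesis
  proof
    show sets\<Lambda>: "sets \<Lambda> = sets ((borel \<Otimes>\<^sub>M borel) \<Otimes>\<^sub>M ?C)"
      unfolding \<Lambda>_def sets_density by (intro sets_pair_measure_cong sets\<gamma> refl)
    note [measurable_cong] = sets\<Lambda>
    have "AE x in distr ?U borel b. x \<in> b ` {..<m}"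
      by (subst AE_distr_iff) (auto simp: borel_closed finite_imp_closed space_uniform_count_measure intro!: AE_I2)
    then have "AE p in \<gamma>. fst p \<in> b ` {..<m}"
      unfolding fst\<gamma>[symmetric] by (rule AE_distrD[rotated]) measurable
    moreover have "(\<Sum>i<m. w (p, i)) = 1" if p: "fst p \<in> b ` {..<m}" for p
    proof -
      obtain k where k: "k < m" "fst p = b k" using p by auto
      have "(\<Sum>i<m. w (p, i)) = (\<Sum>i<m. if b i = b k then ennreal (1 / real (N i)) else 0)"
        by (intro sum.cong) (auto simp: w_def k)
      also have "\<dots> = (\<Sum>i\<in>{i\<in>{..<m}. b i = b k}. ennreal (1 / real (N i)))"
        by (rule sum.inter_filter[symmetric]) simp
      also have "\<dots> = (\<Sum>i\<in>{i\<in>{..<m}. b i = b k}. ennreal (1 / real (N k)))"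
        by (intro sum.cong) (auto simp: N_def)
      also have "\<dots> = ennreal (real (N k) * (1 / real (N k)))"
        by (simp only: sum_constant N_def[symmetric] ennreal_of_nat_eq_real_of_nat)
          (rule ennreal_mult[symmetric]; simp)
      also have "\<dots> = 1" using Npos[OF k(1)] by simp
      finally show ?thesis .
    qed
    \<comment> \<open>The first coordinate almost surely is a sample point, so no mass is lost in the labelling.\<close>
    ultimately have w1: "AE p in \<gamma>. (\<Sum>i<m. w (p, i)) = 1"
      by (auto elim: AE_mp)
    show "distr \<Lambda> (borel \<Otimes>\<^sub>M borel) fst = \<gamma>"
    proof (rule measure_eqI)
      fix A assume "A \<in> sets (distr \<Lambda> (borel \<Otimes>\<^sub>M borel) fst)"
      then have [measurable]: "A \<in> sets (borel \<Otimes>\<^sub>M borel)" by simp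
      have "emeasure (distr \<Lambda> (borel \<Otimes>\<^sub>M borel) fst) A = (\<integral>\<^sup>+q. indicator A (fst q) \<partial>\<Lambda>)"
        by (subst nn_integral_distr[of fst \<Lambda> "borel \<Otimes>\<^sub>M borel" "indicator A", symmetric]) simp_all
      also have "\<dots> = (\<integral>\<^sup>+p. (\<Sum>i<m. w (p, i)) * indicator A p \<partial>\<gamma>)"
        by (subst int) (simp_all add: sum_distrib_right)
      also have "\<dots> = (\<integral>\<^sup>+p. indicator A p \<partial>\<gamma>)"
        using w1 by (intro nn_integral_cong_AE) auto
      finally show "emeasure (distr \<Lambda> (borel \<Otimes>\<^sub>M borel) fst) A = emeasure \<gamma> A" by simp
    qed (simp add: sets\<gamma>)
    show "distr \<Lambda> ?C snd = ?U"
    proof (rule measure_eqI_countable)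
      fix i assume "i \<in> {..<m}"
      then have i: "i < m" by simp
      have "emeasure (distr \<Lambda> ?C snd) {i} = (\<integral>\<^sup>+q. indicator {i} (snd q) \<partial>\<Lambda>)"
        using i by (subst nn_integral_distr[of snd \<Lambda> ?C "indicator {i}", symmetric]) simp_all
      also have "\<dots> = (\<integral>\<^sup>+p. w (p, i) \<partial>\<gamma>)"
      proof (subst int)
        have "(\<Sum>j<m. w (p, j) * indicator {i} (snd (p, j))) = w (p, i)" for p
          using i by (subst sum.remove[of _ i]) (auto intro!: sum.neutral)
        then show "(\<integral>\<^sup>+p. (\<Sum>j<m. w (p, j) * indicator {i} (snd (p, j))) \<partial>\<gamma>) = (\<integral>\<^sup>+p. w (p, i) \<partial>\<gamma>)"
          by simp
      qed (rule measurable_compose[OF measurable_snd], simp)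
      also have "\<dots> = (\<integral>\<^sup>+p. ennreal (1 / real (N i)) * indicator {b i} (fst p) \<partial>\<gamma>)"
        by (intro nn_integral_cong) (auto simp: w_def)
      also have "\<dots> = ennreal (1 / real (N i)) * (\<integral>\<^sup>+p. indicator {b i} (fst p) \<partial>\<gamma>)"
        by (intro nn_integral_cmult) measurable
      also have "(\<integral>\<^sup>+p. indicator {b i} (fst p) \<partial>\<gamma>) = emeasure (distr \<gamma> borel fst) {b i}"
        by (subst nn_integral_distr[of fst \<gamma> borel "indicator {b i}", symmetric]) simp_all
      also have "\<dots> = emeasure ?U {j\<in>{..<m}. b j = b i}"
        unfolding fst\<gamma> by (subst emeasure_distr) (auto simp: space_uniform_count_measure intro!: arg_cong[where f="emeasure ?U"])
      also have "\<dots> = ennreal (real (N i) / real m)"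
        by (subst emeasure_uniform_count_measure) (auto simp: N_def)
      also have "ennreal (1 / real (N i)) * \<dots> = ennreal (1 / real m)"
        using Npos[OF i] by (simp add: ennreal_mult[symmetric] del: ennreal_mult)
      also have "\<dots> = emeasure ?U {i}"
        using i by (subst emeasure_uniform_count_measure) auto
      finally show "emeasure (distr \<Lambda> ?C snd) {i} = emeasure ?U {i}" .
    qed (auto simp: sets_uniform_count_measure)
    show "AE q in \<Lambda>. fst (fst q) = b (snd q)"
      unfolding \<Lambda>_def by (subst AE_density) (auto simp: w_def intro!: AE_I2)
  qed
qed

lemma sqrt_ennreal_ennreal: "r \<ge> 0 \<Longrightarrow> sqrt_ennreal (ennreal r) = ennreal (sqrt r)"
  by (simp add: sqrt_ennreal_def)

lemma sqrt_ennreal_mono: "x \<le> y \<Longrightarrow> sqrt_ennreal x \<le> sqrt_ennreal y"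
  by (auto simp: sqrt_ennreal_def top_unique intro!: ennreal_leI enn2real_mono simp: less_top)

text \<open>
  Move the sample points along a labelled version of a given coupling. Each distance grows by at
  most \<open>\<epsilon>\<close>, so by Jensen's inequality the root of the cost does as well.
\<close>

lemma W2_perturb:
  fixes a b :: "nat \<Rightarrow> 'a::euclidean_space"
  assumes m: "m \<ge> 1" and \<epsilon>: "\<And>i. i < m \<Longrightarrow> norm (a i - b i) \<le> \<epsilon>"
  shows "W2 (distr (uniform_count_measure {..<m}) borel a) \<nu>
    \<le> W2 (distr (uniform_count_measure {..<m}) borel b) \<nu> + ennreal \<epsilon>"
proof -
  let ?U = "uniform_count_measure {..<m}" and ?C = "count_space {..<m}"
  have [measurable]: "a \<in> ?C \<rightarrow>\<^sub>M borel" by (auto simp: measurable_def)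
  have \<epsilon>0: "\<epsilon> \<ge> 0" using \<epsilon>[of 0] m norm_ge_zero[of "a 0 - b 0"] by linarith
  have "W2 (distr ?U borel a) \<nu>
    \<le> sqrt_ennreal (\<integral>\<^sup>+(x, y). ennreal ((norm (x - y))\<^sup>2) \<partial>\<gamma>) + ennreal \<epsilon>"
    if \<gamma>: "\<gamma> \<in> couplings (distr ?U borel b) \<nu>" for \<gamma>
  proof (cases "(\<integral>\<^sup>+(x, y). ennreal ((norm (x - y))\<^sup>2) \<partial>\<gamma>) = \<infinity>")
    case True
    then show ?thesis by (simp add: sqrt_ennreal_def)
  next
    case False
    obtain \<Lambda> :: "(('a \<times> 'a) \<times> nat) measure" where
        sets\<Lambda>: "sets \<Lambda> = sets ((borel \<Otimes>\<^sub>M borel) \<Otimes>\<^sub>M ?C)"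
      and fst\<Lambda>: "distr \<Lambda> (borel \<Otimes>\<^sub>M borel) fst = \<gamma>"
      and snd\<Lambda>: "distr \<Lambda> ?C snd = ?U"
      and AE\<Lambda>: "AE q in \<Lambda>. fst (fst q) = b (snd q)"
      using labelled_coupling[OF m \<gamma>] .
    note [measurable_cong] = sets\<Lambda>
    have sp: "space \<Lambda> = UNIV \<times> {..<m}"
      using sets_eq_imp_space_eq[OF sets\<Lambda>] by (simp add: space_pair_measure)
    have \<gamma>p: "prob_space \<gamma>" and snd\<gamma>: "distr \<gamma> borel snd = \<nu>"
      using \<gamma> by (auto simp: couplings_def)
    interpret \<Lambda>: prob_space \<Lambda>
      using \<gamma>p unfolding fst\<Lambda>[symmetric] by (rule prob_space_distrD[rotated]) measurable
    let ?f = "\<lambda>q. (a (snd q), snd (fst q))"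
    have [measurable]: "?f \<in> \<Lambda> \<rightarrow>\<^sub>M borel \<Otimes>\<^sub>M borel" by measurable
    define \<gamma>' where "\<gamma>' = distr \<Lambda> (borel \<Otimes>\<^sub>M borel) ?f"
    have \<gamma>': "\<gamma>' \<in> couplings (distr ?U borel a) \<nu>"
    proof -
      have "distr \<gamma>' borel fst = distr (distr \<Lambda> ?C snd) borel a"
        unfolding \<gamma>'_def by (simp add: distr_distr comp_def)
      moreover have "distr \<gamma>' borel snd = distr (distr \<Lambda> (borel \<Otimes>\<^sub>M borel) fst) borel snd"
        unfolding \<gamma>'_def by (simp add: distr_distr comp_def)
      ultimately show ?thesis
        unfolding couplings_def
        by (auto simp: \<gamma>'_def fst\<Lambda> snd\<Lambda> snd\<gamma> intro!: \<Lambda>.prob_space_distr)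
    qed
    define s where "s q = norm (fst (fst q) - snd (fst q))" for q :: "('a \<times> 'a) \<times> nat"
    have [measurable]: "s \<in> borel_measurable \<Lambda>" unfolding s_def by measurable
    have costs: "(\<integral>\<^sup>+(x, y). ennreal ((norm (x - y))\<^sup>2) \<partial>\<gamma>) = (\<integral>\<^sup>+q. ennreal ((s q)\<^sup>2) \<partial>\<Lambda>)"
      unfolding fst\<Lambda>[symmetric] s_def case_prod_beta by (subst nn_integral_distr) simp_all
    have int2: "integrable \<Lambda> (\<lambda>q. (s q)\<^sup>2)"
      using False unfolding costs by (intro integrableI_nonneg) (auto simp: top.not_eq_extremum)
    have int1: "integrable \<Lambda> s" by (rule \<Lambda>.square_integrable_imp_integrable) (use int2 in auto)
    define c where "c = \<Lambda>.expectation (\<lambda>q. (s q)\<^sup>2)"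
    have c: "c \<ge> 0" unfolding c_def by (intro Bochner_Integration.integral_nonneg) simp
    have costs': "(\<integral>\<^sup>+(x, y). ennreal ((norm (x - y))\<^sup>2) \<partial>\<gamma>) = ennreal c"
      unfolding costs c_def by (rule nn_integral_eq_integral[OF int2]) simp
    have "(\<Lambda>.expectation s)\<^sup>2 \<le> c" unfolding c_def by (rule \<Lambda>.square_expectation_le) (use int2 in auto)
    then have Es: "\<Lambda>.expectation s \<le> sqrt c" by (rule real_le_rsqrt)
    have "(\<integral>\<^sup>+(x, y). ennreal ((norm (x - y))\<^sup>2) \<partial>\<gamma>') = (\<integral>\<^sup>+q. ennreal ((norm (a (snd q) - snd (fst q)))\<^sup>2) \<partial>\<Lambda>)"
      unfolding \<gamma>'_def case_prod_beta by (subst nn_integral_distr) simp_all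
    also have "\<dots> \<le> (\<integral>\<^sup>+q. ennreal ((s q)\<^sup>2 + 2 * \<epsilon> * s q + \<epsilon>\<^sup>2) \<partial>\<Lambda>)"
    proof (rule nn_integral_mono_AE)
      show "AE q in \<Lambda>. ennreal ((norm (a (snd q) - snd (fst q)))\<^sup>2) \<le> ennreal ((s q)\<^sup>2 + 2 * \<epsilon> * s q + \<epsilon>\<^sup>2)"
        using AE\<Lambda> AE_space
      proof eventually_elim
        case (elim q)
        then have "norm (a (snd q) - snd (fst q)) \<le> s q + \<epsilon>"
          using norm_triangle_ineq[of "a (snd q) - b (snd q)" "b (snd q) - snd (fst q)"]
            \<epsilon>[of "snd q"] by (auto simp: s_def sp)
        then have "(norm (a (snd q) - snd (fst q)))\<^sup>2 \<le> (s q + \<epsilon>)\<^sup>2"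
          by (intro power_mono) auto
        then show "ennreal ((norm (a (snd q) - snd (fst q)))\<^sup>2) \<le> ennreal ((s q)\<^sup>2 + 2 * \<epsilon> * s q + \<epsilon>\<^sup>2)"
          by (intro ennreal_leI) (simp add: power2_sum algebra_simps)
      qed
    qed
    also have "\<dots> = ennreal (\<Lambda>.expectation (\<lambda>q. (s q)\<^sup>2 + 2 * \<epsilon> * s q + \<epsilon>\<^sup>2))"
    proof (rule nn_integral_eq_integral)
      show "integrable \<Lambda> (\<lambda>q. (s q)\<^sup>2 + 2 * \<epsilon> * s q + \<epsilon>\<^sup>2)"
        by (intro Bochner_Integration.integrable_add integrable_mult_right int1 int2 \<Lambda>.integrable_const)
    qed (use \<epsilon>0 in \<open>simp add: s_def\<close>)
    also have "\<Lambda>.expectation (\<lambda>q. (s q)\<^sup>2 + 2 * \<epsilon> * s q + \<epsilon>\<^sup>2) = c + 2 * \<epsilon> * \<Lambda>.expectation s + \<epsilon>\<^sup>2"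
      using int1 int2 by (simp add: c_def \<Lambda>.prob_space)
    also have "ennreal \<dots> \<le> ennreal ((sqrt c + \<epsilon>)\<^sup>2)"
      using c mult_left_mono[OF Es, of "2 * \<epsilon>"] \<epsilon>0
      by (intro ennreal_leI) (simp add: power2_sum mult_ac)
    finally have cost': "(\<integral>\<^sup>+(x, y). ennreal ((norm (x - y))\<^sup>2) \<partial>\<gamma>') \<le> ennreal ((sqrt c + \<epsilon>)\<^sup>2)" .
    have "W2 (distr ?U borel a) \<nu> \<le> sqrt_ennreal (\<integral>\<^sup>+(x, y). ennreal ((norm (x - y))\<^sup>2) \<partial>\<gamma>')"
      unfolding W2_def by (rule INF_lower[OF \<gamma>'])
    also have "\<dots> \<le> sqrt_ennreal (ennreal ((sqrt c + \<epsilon>)\<^sup>2))"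
      using cost' by (rule sqrt_ennreal_mono)
    also have "\<dots> = sqrt_ennreal (ennreal c) + ennreal \<epsilon>"
      using c \<epsilon>0 by (simp add: sqrt_ennreal_ennreal)
    finally show ?thesis unfolding costs' .
  qed
  then have "W2 (distr ?U borel a) \<nu> - ennreal \<epsilon> \<le> W2 (distr ?U borel b) \<nu>"
    unfolding W2_def[of "distr ?U borel b"]
    by (intro INF_greatest) (simp add: ennreal_minus_le_iff add.commute)
  then show ?thesis by (simp add: ennreal_minus_le_iff add.commute)
qed


text \<open>
  Under any coupling the difference of the means is the mean of the difference, and its square is
  at most the transport cost.
\<close>

lemma mean_difference_le_W2:
  fixes \<tau> \<nu> :: "real measure"
  assumes \<tau>: "integrable \<tau> (\<lambda>x. x)" and \<nu>: "integrable \<nu> (\<lambda>x. x)"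
  shows "ennreal \<bar>(\<integral>x. x \<partial>\<tau>) - (\<integral>x. x \<partial>\<nu>)\<bar> \<le> W2 \<tau> \<nu>"
  unfolding W2_def
proof (rule INF_greatest)
  fix \<gamma> assume "\<gamma> \<in> couplings \<tau> \<nu>"
  then have p: "prob_space \<gamma>" and sets\<gamma>: "sets \<gamma> = sets (borel \<Otimes>\<^sub>M borel)"
    and \<gamma>1: "distr \<gamma> borel fst = \<tau>" and \<gamma>2: "distr \<gamma> borel snd = \<nu>"
    by (auto simp: couplings_def)
  note [measurable_cong] = sets\<gamma>
  interpret prob_space \<gamma> by fact
  let ?I = "\<integral>\<^sup>+(x, y). ennreal ((norm (x - y))\<^sup>2) \<partial>\<gamma>"
  have i1: "integrable \<gamma> fst" using \<tau> unfolding \<gamma>1[symmetric] by (subst (asm) integrable_distr_eq) simp_all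
  have i2: "integrable \<gamma> snd" using \<nu> unfolding \<gamma>2[symmetric] by (subst (asm) integrable_distr_eq) simp_all
  have e1: "(\<integral>x. x \<partial>\<tau>) = expectation fst" unfolding \<gamma>1[symmetric] by (subst integral_distr) simp_all
  have e2: "(\<integral>x. x \<partial>\<nu>) = expectation snd" unfolding \<gamma>2[symmetric] by (subst integral_distr) simp_all
  have e: "(\<integral>x. x \<partial>\<tau>) - (\<integral>x. x \<partial>\<nu>) = expectation (\<lambda>p. fst p - snd p)"
    unfolding e1 e2 by (rule Bochner_Integration.integral_diff[OF i1 i2, symmetric])
  show "ennreal \<bar>(\<integral>x. x \<partial>\<tau>) - (\<integral>x. x \<partial>\<nu>)\<bar> \<le> sqrt_ennreal ?I"
  proof (cases "?I = \<infinity>")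
    case True
    then show ?thesis by (simp add: sqrt_ennreal_def)
  next
    case False
    have I: "?I = (\<integral>\<^sup>+p. ennreal ((fst p - snd p)\<^sup>2) \<partial>\<gamma>)"
      by (intro nn_integral_cong) (simp add: case_prod_beta)
    have int2: "integrable \<gamma> (\<lambda>p. (fst p - snd p)\<^sup>2)"
      using False unfolding I by (intro integrableI_nonneg) (auto simp: top.not_eq_extremum)
    have "?I = ennreal (expectation (\<lambda>p. (fst p - snd p)\<^sup>2))"
      unfolding I by (rule nn_integral_eq_integral[OF int2]) simp
    then have "sqrt_ennreal ?I = ennreal (sqrt (expectation (\<lambda>p. (fst p - snd p)\<^sup>2)))"
      by (simp add: sqrt_ennreal_ennreal)
    moreover have "\<bar>expectation (\<lambda>p. fst p - snd p)\<bar> \<le> sqrt (expectation (\<lambda>p. (fst p - snd p)\<^sup>2))"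
      by (rule real_le_rsqrt) (use square_expectation_le[OF _ int2] in simp)
    ultimately show ?thesis unfolding e by (simp add: ennreal_leI)
  qed
qed

section \<open>Measurability of the sliced distance to the sample\<close>

lemma empirical_eq_distr:
  assumes m: "m \<ge> 1" and x: "\<And>i. i < m \<Longrightarrow> x i \<in> space (euc d)"
  shows "empirical d m x = distr (uniform_count_measure {..<m}) (euc d) x"
proof (rule measure_eqI)
  let ?U = "uniform_count_measure {..<m}"
  have meas: "x \<in> ?U \<rightarrow>\<^sub>M euc d"
    using x by (auto simp: measurable_def space_uniform_count_measure sets_uniform_count_measure)
  have D: "emeasure (distr ?U (euc d) x) A = (\<Sum>i<m. emeasure (return (euc d) (x i)) A) / of_nat m"
    if A: "A \<in> sets (euc d)" for A
  proof -
    have "emeasure (distr ?U (euc d) x) A = ennreal (real (card {i\<in>{..<m}. x i \<in> A}) / real m)"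
      using emeasure_uniform_count_measure[of "{..<m}" "{i\<in>{..<m}. x i \<in> A}"]
      unfolding emeasure_distr[OF meas A]
      by (auto simp: space_uniform_count_measure vimage_def Int_def conj_commute)
    also have "\<dots> = of_nat (card {i\<in>{..<m}. x i \<in> A}) / of_nat m"
      using m by (simp add: divide_ennreal[symmetric] ennreal_of_nat_eq_real_of_nat)
    also have "of_nat (card {i\<in>{..<m}. x i \<in> A}) = (\<Sum>i<m. indicator A (x i) :: ennreal)"
      by (simp add: indicator_def sum.If_cases Int_def)
    also have "\<dots> = (\<Sum>i<m. emeasure (return (euc d) (x i)) A)"
      using A by simp
    finally show ?thesis .
  qed
  show sets: "sets (empirical d m x) = sets (distr ?U (euc d) x)"
    by (simp add: empirical_def sets.sets_measure_of_eq)
  fix A assume "A \<in> sets (empirical d m x)"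
  then have A: "A \<in> sets (euc d)" unfolding sets by simp
  show "emeasure (empirical d m x) A = emeasure (distr ?U (euc d) x) A"
    unfolding D[OF A]
  proof (rule emeasure_measure_of[OF empirical_def])
    show "sets (euc d) \<subseteq> Pow (space (euc d))" by (rule sets.space_closed)
    show "A \<in> sets (empirical d m x)" by fact
    let ?\<mu> = "\<lambda>A. (\<Sum>i<m. emeasure (return (euc d) (x i)) A) / of_nat m"
    show "positive (sets (empirical d m x)) ?\<mu>" by (simp add: positive_def)
    show "countably_additive (sets (empirical d m x)) ?\<mu>"
    proof (rule countably_additiveI)
      fix B :: "nat \<Rightarrow> _"
      assume B: "range B \<subseteq> sets (empirical d m x)" "disjoint_family B"
      have B': "range B \<subseteq> sets (distr ?U (euc d) x)" using B(1) unfolding sets .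
      have "(\<Sum>n. ?\<mu> (B n)) = (\<Sum>n. emeasure (distr ?U (euc d) x) (B n))"
        using B' by (intro suminf_cong) (auto simp: D)
      also have "\<dots> = emeasure (distr ?U (euc d) x) (\<Union>n. B n)"
        using B' B(2) by (rule suminf_emeasure)
      also have "\<dots> = ?\<mu> (\<Union>n. B n)" using B' by (intro D) auto
      finally show "(\<Sum>n. ?\<mu> (B n)) = ?\<mu> (\<Union>n. B n)" .
    qed
  qed
qed

lemma inner_euc_measurable [measurable]: "(\<lambda>x. inner_euc d x \<theta>) \<in> borel_measurable (euc d)"
  unfolding inner_euc_def euc_def by measurable

lemma marginal_empirical:
  assumes "m \<ge> 1" and "\<And>i. i < m \<Longrightarrow> x i \<in> space (euc d)"
  shows "marginal d \<theta> (empirical d m x)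
    = distr (uniform_count_measure {..<m}) borel (\<lambda>i. inner_euc d (x i) \<theta>)"
proof -
  have "x \<in> uniform_count_measure {..<m} \<rightarrow>\<^sub>M euc d"
    using assms by (auto simp: measurable_def space_uniform_count_measure sets_uniform_count_measure)
  then show ?thesis
    by (simp add: marginal_def empirical_eq_distr[OF assms] distr_distr comp_def)
qed

text \<open>
  The sample is regarded as a point of the topological space \<^typ>\<open>nat \<Rightarrow> nat \<Rightarrow> real\<close>, whose
  Borel sets are those of the product sigma-algebra. Openness for each single direction is enough
  to treat an uncountable supremum over directions.
\<close>

lemma open_W2_empirical_greater:
  assumes m: "m \<ge> 1"
  shows "open {z :: nat \<Rightarrow> nat \<Rightarrow> real.
    t < W2 (distr (uniform_count_measure {..<m}) borel (\<lambda>i. inner_euc d (z i) \<theta>)) \<nu>}"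
    (is "open {z. t < ?W z}")
proof (rule Topological_Spaces.openI)
  fix z assume "z \<in> {z. t < ?W z}"
  then have z: "t < ?W z" by simp
  then obtain r where r: "t < r" "r < ?W z" using dense by blast
  obtain t' where t': "t = ennreal t'" "t' \<ge> 0" using r by (cases t) auto
  obtain r' where r': "r = ennreal r'" "r' \<ge> 0" using r by (cases r) auto
  define \<epsilon> where "\<epsilon> = r' - t'"
  have \<epsilon>: "\<epsilon> > 0" using r(1) t' r' by (simp add: \<epsilon>_def ennreal_less_iff)
  have r_eq: "r = t + ennreal \<epsilon>" using t' r' \<epsilon> by (simp add: \<epsilon>_def flip: ennreal_plus)
  define G where "G = (\<Inter>i\<in>{..<m}. {z'. \<bar>inner_euc d (z i) \<theta> - inner_euc d (z' i) \<theta>\<bar> < \<epsilon>})"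
  have [continuous_intros]: "continuous_on UNIV (\<lambda>z :: nat \<Rightarrow> nat \<Rightarrow> real. z i j)" for i j
    by (intro continuous_on_product_then_coordinatewise[OF continuous_on_product_coordinates])
  have "open G"
    unfolding G_def inner_euc_def
    by (intro open_INT ballI open_Collect_less continuous_intros) auto
  moreover have "z \<in> G" using \<epsilon> by (simp add: G_def)
  moreover have "G \<subseteq> {z. t < ?W z}"
  proof
    fix z' assume "z' \<in> G"
    then have "?W z \<le> ?W z' + ennreal \<epsilon>"
      by (intro W2_perturb m) (auto simp: G_def less_imp_le)
    then have "r < ?W z' + ennreal \<epsilon>" using r(2) by (rule order.strict_trans2[rotated])
    then show "z' \<in> {z. t < ?W z}"
      unfolding r_eq using add_right_mono[of "?W z'" t "ennreal \<epsilon>"] by (auto simp: not_le[symmetric])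
  qed
  ultimately show "\<exists>T. open T \<and> z \<in> T \<and> T \<subseteq> {z. t < ?W z}" by blast
qed

text \<open>
  A supremum of lower semicontinuous functions is lower semicontinuous, hence Borel. The map \<open>?z\<close>
  in the proof forgets the values outside the index ranges, where extensional functions are
  \<^const>\<open>undefined\<close>.
\<close>

lemma SW2_empirical_measurable:
  assumes m: "m \<ge> 1" and \<mu>: "sets \<mu> = sets (euc d)"
  shows "(\<lambda>x. SW2 d (empirical d m x) \<nu>) \<in> borel_measurable (sample_space m \<mu>)"
proof (rule borel_measurableI_greater)
  fix t :: ennreal
  let ?W = "\<lambda>\<theta> (z :: nat \<Rightarrow> nat \<Rightarrow> real).
    W2 (distr (uniform_count_measure {..<m}) borel (\<lambda>i. inner_euc d (z i) \<theta>)) (marginal d \<theta> \<nu>)"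
  have [measurable_cong]: "sets (sample_space m \<mu>) = sets (\<Pi>\<^sub>M i\<in>{..<m}. euc d)"
    unfolding sample_space_def using \<mu> by (intro sets_PiM_cong) auto
  have sp: "x i \<in> space (euc d)" if "x \<in> space (sample_space m \<mu>)" "i < m" for x i
    using that sets_eq_imp_space_eq[OF \<mu>] by (auto simp: sample_space_def space_PiM)
  let ?z = "\<lambda>x i j. if i < m \<and> j < d then x i j else 0 :: real"
  have coord: "(\<lambda>x. ?z x i j) \<in> borel_measurable (sample_space m \<mu>)" for i j
  proof (cases "i < m \<and> j < d")
    case True
    then have "(\<lambda>x. x i) \<in> (\<Pi>\<^sub>M i\<in>{..<m}. euc d) \<rightarrow>\<^sub>M euc d" by (intro measurable_component_singleton) simp
    then have "(\<lambda>x. x i) \<in> sample_space m \<mu> \<rightarrow>\<^sub>M euc d" by measurable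
    moreover have "(\<lambda>y. y j) \<in> borel_measurable (euc d)" 
      using True unfolding euc_def by (intro measurable_component_singleton) simp
    ultimately show ?thesis using True by (simp add: measurable_compose)
  qed auto
  have z: "?z \<in> borel_measurable (sample_space m \<mu>)"
    by (intro measurable_coordinatewise_then_product coord)
  have open': "open (\<Union>\<theta>\<in>unit_sphere d. {z. t < ?W \<theta> z})"
    by (intro open_UN ballI open_W2_empirical_greater m)
  have "{x \<in> space (sample_space m \<mu>). t < SW2 d (empirical d m x) \<nu>}
    = ?z -` (\<Union>\<theta>\<in>unit_sphere d. {z. t < ?W \<theta> z}) \<inter> space (sample_space m \<mu>)"
  proof -
    have "W2 (marginal d \<theta> (empirical d m x)) (marginal d \<theta> \<nu>) = ?W \<theta> (?z x)"
      if x: "x \<in> space (sample_space m \<mu>)" for x \<theta>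
    proof -
      have "distr (uniform_count_measure {..<m}) borel (\<lambda>i. inner_euc d (x i) \<theta>)
        = distr (uniform_count_measure {..<m}) borel (\<lambda>i. inner_euc d (?z x i) \<theta>)"
        by (intro distr_cong) (auto simp: space_uniform_count_measure inner_euc_def)
      then show ?thesis by (simp add: marginal_empirical[OF m sp[OF x]])
    qed
    then show ?thesis by (auto simp: SW2_def less_SUP_iff)
  qed
  also have "\<dots> \<in> sets (sample_space m \<mu>)"
    by (rule measurable_sets[OF z]) (use open' in simp)
  finally show "{x \<in> space (sample_space m \<mu>). t < SW2 d (empirical d m x) \<nu>} \<in> sets (sample_space m \<mu>)" .
qed

section \<open>The lower bound for the sliced distance\<close>

text \<open>
  The direction of the sample mean is the best one: projected onto it, the empirical measure has
  mean \<open>\<parallel>X\<^sub>1 + \<dots> + X\<^sub>m\<parallel> / m\<close>, while every marginal of a centred law has mean zero.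
\<close>

lemma norm_mean_le_SW2:
  assumes m: "m \<ge> 1" and x: "\<And>i. i < m \<Longrightarrow> x i \<in> space (euc d)"
    and \<mu>: "prob_law d \<mu>" "centred d \<mu>"
  shows "ennreal (L2_set (\<lambda>j. \<Sum>i<m. x i j) {..<d} / real m) \<le> SW2 d (empirical d m x) \<mu>"
proof (cases "L2_set (\<lambda>j. \<Sum>i<m. x i j) {..<d} = 0")
  case True
  then show ?thesis by simp
next
  case False
  let ?S = "\<lambda>j. \<Sum>i<m. x i j" and ?U = "uniform_count_measure {..<m}"
  let ?n = "L2_set ?S {..<d}"
  have n: "?n > 0" using False by (simp add: less_le)
  define \<theta> where "\<theta> = (\<lambda>j\<in>{..<d}. ?S j / ?n)"
  have "L2_set \<theta> {..<d} = L2_set (\<lambda>j. ?S j * (1 / ?n)) {..<d}"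
    by (intro L2_set_cong) (auto simp: \<theta>_def)
  also have "\<dots> = ?n * (1 / ?n)" by (rule L2_set_left_distrib[symmetric]) simp
  finally have \<theta>: "\<theta> \<in> unit_sphere d"
    using n by (auto simp: unit_sphere_def euc_def space_PiM \<theta>_def)
  let ?\<tau> = "marginal d \<theta> (empirical d m x)" and ?\<nu> = "marginal d \<theta> \<mu>"
  have [measurable]: "(\<lambda>i. inner_euc d (x i) \<theta>) \<in> borel_measurable ?U"
    by (auto simp: measurable_def space_uniform_count_measure sets_uniform_count_measure)
  have \<tau>: "?\<tau> = distr ?U borel (\<lambda>i. inner_euc d (x i) \<theta>)" by (rule marginal_empirical[OF m x])
  have \<tau>1: "integrable ?\<tau> (\<lambda>x. x)"
    unfolding \<tau> by (subst integrable_distr_eq) (auto simp: uniform_count_measure_def intro: integrable_point_measure_finite)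
  have "(\<integral>x. x \<partial>?\<tau>) = (\<Sum>i<m. inner_euc d (x i) \<theta>) / real m"
    unfolding \<tau> by (subst integral_distr) (auto simp: integral_uniform_count_measure)
  also have "(\<Sum>i<m. inner_euc d (x i) \<theta>) = (\<Sum>j<d. (?S j)\<^sup>2) / ?n"
    unfolding inner_euc_def by (subst sum.swap)
      (simp add: \<theta>_def sum_distrib_right[symmetric] sum_divide_distrib[symmetric] power2_eq_square cong: sum.cong_simp)
  also have "(\<Sum>j<d. (?S j)\<^sup>2) = ?n\<^sup>2" by (simp add: L2_set_sum_squares)
  finally have \<tau>2: "(\<integral>x. x \<partial>?\<tau>) = ?n / real m" by (simp add: power2_eq_square)
  have [measurable_cong]: "sets \<mu> = sets (euc d)" using \<mu> by (simp add: prob_law_def)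
  have i: "integrable \<mu> (\<lambda>x. inner_euc d x \<theta>)" "(\<integral>x. inner_euc d x \<theta> \<partial>\<mu>) = 0"
    using \<mu>(2) by (auto simp: inner_euc_def centred_def)
  have \<nu>1: "integrable ?\<nu> (\<lambda>x. x)" unfolding marginal_def by (subst integrable_distr_eq) (use i in auto)
  have \<nu>2: "(\<integral>x. x \<partial>?\<nu>) = 0" unfolding marginal_def by (subst integral_distr) (use i in auto)
  have "ennreal (?n / real m) \<le> W2 ?\<tau> ?\<nu>"
    using mean_difference_le_W2[OF \<tau>1 \<nu>1] unfolding \<tau>2 \<nu>2 by simp
  also have "\<dots> \<le> SW2 d (empirical d m x) \<mu>"
    unfolding SW2_def using \<theta> by (rule SUP_upper)
  finally show ?thesis .
qed

theorem lemma3p1: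
  fixes \<beta> :: real
  assumes "0 < \<beta>" and "\<beta> < 1"
  shows "\<exists>c0 c1 :: real. c0 > 0 \<and> c1 > 0 \<and>
    (\<forall>(d::nat) (m::nat) (\<mu> :: (nat \<Rightarrow> real) measure).
       d \<ge> 1 \<longrightarrow> m \<ge> 1 \<longrightarrow> prob_law d \<mu> \<longrightarrow> centred d \<mu> \<longrightarrow> isotropic d \<mu> \<longrightarrow>
       (\<integral>x. L2_set x {..<d} \<partial>\<mu>) \<ge> \<beta> * sqrt (real d) \<longrightarrow>
       measure (sample_space m \<mu>)
         {x \<in> space (sample_space m \<mu>).
            SW2 d (empirical d m x) \<mu> \<ge> ennreal (c1 * sqrt (real d / real m))} \<ge> c0)"
proof (rule exI[of _ "(9 / 64 * \<beta>)\<^sup>2"], rule exI[of _ "9 / 64 * \<beta>"], intro conjI allI impI)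
  show "(9 / 64 * \<beta>)\<^sup>2 > 0" and "9 / 64 * \<beta> > 0" using \<open>0 < \<beta>\<close> by auto
  fix d m :: nat and \<mu> :: "(nat \<Rightarrow> real) measure"
  assume d: "d \<ge> 1" and m: "m \<ge> 1" and \<mu>: "prob_law d \<mu>" "centred d \<mu>" "isotropic d \<mu>"
    and \<beta>: "(\<integral>x. L2_set x {..<d} \<partial>\<mu>) \<ge> \<beta> * sqrt (real d)"
  interpret isotropic_sample d \<mu> m by unfold_locales (use \<mu> m in auto)
  let ?large = "{x\<in>space P. 9 / 64 * \<beta> * sqrt (real m * real d) \<le> L2_set (block_sum {..<m} x) {..<d}}"
  let ?far = "{x\<in>space P. SW2 d (empirical d m x) \<mu> \<ge> ennreal (9 / 64 * \<beta> * sqrt (real d / real m))}"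
  have sub: "?large \<subseteq> ?far"
  proof
    fix x assume "x \<in> ?large"
    then have x: "x \<in> space P"
      and large: "9 / 64 * \<beta> * sqrt (real m * real d) \<le> L2_set (block_sum {..<m} x) {..<d}" by auto
    have sp: "x i \<in> space (euc d)" if "i < m" for i
      using x that sets_eq_imp_space_eq[OF sets_law] by (auto simp: P_eq space_PiM)
    have "sqrt (real d / real m) = sqrt (real m * real d) / real m"
      using m by (simp add: real_sqrt_divide real_sqrt_mult field_simps)
    then have "9 / 64 * \<beta> * sqrt (real d / real m) \<le> L2_set (block_sum {..<m} x) {..<d} / real m"
      using divide_right_mono[OF large, of "real m"] by simp
    also have "block_sum {..<m} x = (\<lambda>j. \<Sum>i<m. x i j)" by (simp add: block_sum_def fun_eq_iff)
    finally have "ennreal (9 / 64 * \<beta> * sqrt (real d / real m)) \<le> SW2 d (empirical d m x) \<mu>"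
      using norm_mean_le_SW2[OF m sp \<mu>(1,2)] by (meson ennreal_leI order_trans)
    then show "x \<in> ?far" using x by simp
  qed
  have [measurable]: "(\<lambda>x. SW2 d (empirical d m x) \<mu>) \<in> borel_measurable P"
    unfolding P_def by (rule SW2_empirical_measurable[OF m sets_law])
  have "(9 / 64 * \<beta>)\<^sup>2 \<le> P.prob ?large" by (rule norm_sum_large[OF d \<open>0 < \<beta>\<close> \<beta>])
  also have "\<dots> \<le> P.prob ?far" by (rule P.finite_measure_mono[OF sub]) measurable
  finally show "(9 / 64 * \<beta>)\<^sup>2 \<le> measure (sample_space m \<mu>)
      {x \<in> space (sample_space m \<mu>).
        SW2 d (empirical d m x) \<mu> \<ge> ennreal (9 / 64 * \<beta> * sqrt (real d / real m))}"
    unfolding P_def .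
qed

end
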